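(* Let $A\ne B$ be points on the side of a soup can $S$ with height $h$ (one or both may lie on a rim). Position $S$ so that $A$ has cylindrical angle $0$ and $B$ has cylindrical angle $\theta$, where $\theta\in[0,\pi]$ is the angle between $\Gamma_A$ and $\Gamma_B$. Let $a$ and $b$ be the respective distances from $A$ and $B$ to the rim $T_1$ of the lid. For $t,u\in[0,\theta]$ let $\gamma_1$ be the classical minimal geodesic on the side from $A$ to $P_1[1,t,h]\in T_1$, let $\gamma_2$ be the classical minimal geodesic on the side from $P_2[1,\theta-u,h]\in T_1$ to $B$, and let $\gamma_3=\overline{P_1P_2}$ on the lid. Then $$\ell_1(t,u)=\mathrm{length}(\gamma_1\cup\gamma_2\cup\gamma_3)=\sqrt{a^2+t^2}+\sqrt{b^2+u^2}+\sqrt{2-2\cos(\theta-t-u)}.$$ Furthermore, let $\gamma_4$ be the classical minimal geodesic on the side from $A$ to $Q_1[1,t,0]\in T_2$, let $\gamma_5$ be the classical minimal geodesic on the side from $Q_2[1,\theta-u,0]\in T_2$ to $B$, and let $\gamma_6=\overline{Q_1Q_2}$ on the base. Then $$\ell_2(t,u)=\mathrm{length}(\gamma_4\cup\gamma_5\cup\gamma_6)=\sqrt{(h-a)^2+t^2}+\sqrt{(h-b)^2+u^2}+\sqrt{2-2\cos(\theta-t-u)}.$$ Candidates for a minimizer are: (a) a classical minimal geodesic $\alpha$ from $A$ to $B$ on the side, (b) a path $\beta_1=\gamma_1\cup\gamma_2\cup\gamma_3$ across the lid of minimal length $\ell_1(t_1,u_1)=\min_{[0,\theta]^2}\ell_1$,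 or (c) a path $\beta_2=\gamma_4\cup\gamma_5\cup\gamma_6$ across the base of minimal length $\ell_2(t_2,u_2)=\min_{[0,\theta]^2}\ell_2$. A path of smallest length in $\{\alpha,\beta_1,\beta_2\}$ is a minimal path on $S$ from $A$ to $B$.
   Context: A soup can of height $h>0$ is the closed surface $S\subset\mathbb{R}^3$ which in cylindrical coordinates $[r,\vartheta,z]$ is the union of the side $\{r=1,\ 0\le z\le h\}$, the lid $U_1=\{r\le 1,\ z=h\}$ and the base $U_2=\{r\le 1,\ z=0\}$; its rims are $T_1=\partial U_1$ and $T_2=\partial U_2$. $P[r,\vartheta,z]$ denotes the point $P$ with these cylindrical coordinates. For a point $P$ of $S$ not on the axis of revolution $r=0$, $\Gamma_P$ is the closed half-plane containing $P$ and bounded by the axis. A path on $S$ from $A$ to $B$ is a continuous map from a compact interval to $S$ starting at $A$ and ending at $B$; it is minimal if its length is at most that of every path on $S$ from $A$ to $B$. A classical minimal geodesic on the side is a shortest path among paths lying on the side. *)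

theory Defs
  imports "HOL-Analysis.Analysis"
begin

definition cyl :: "real \<Rightarrow> real \<Rightarrow> real \<Rightarrow> real^3" where
  "cyl r \<phi> z = vector [r * cos \<phi>, r * sin \<phi>, z]"

definition side :: "real \<Rightarrow> (real^3) set" where
  "side h = {cyl 1 \<phi> z | \<phi> z. 0 \<le> z \<and> z \<le> h}"

definition lid :: "real \<Rightarrow> (real^3) set" where
  "lid h = {cyl r \<phi> h | r \<phi>. 0 \<le> r \<and> r \<le> 1}"

definition base :: "(real^3) set" where
  "base = {cyl r \<phi> 0 | r \<phi>. 0 \<le> r \<and> r \<le> 1}"

definition soup_can :: "real \<Rightarrow> (real^3) set" where
  "soup_can h = side h \<union> lid h \<union> base"

definition lid_rim :: "real \<Rightarrow> (real^3) set" where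
  "lid_rim h = {cyl 1 \<phi> h | \<phi>. True}"

text \<open>The closed half-plane through \<open>P\<close> bounded by the third coordinate axis
  (meaningful for \<open>P\<close> off that axis).\<close>

definition half_plane :: "real^3 \<Rightarrow> (real^3) set" where
  "half_plane P = {vector [s * P $ 1, s * P $ 2, z] | s z. 0 \<le> s}"

text \<open>The angle in \<open>[0, \<pi>]\<close> between two half-planes bounded by the third coordinate axis is
  the angle between the unit vectors in them that are orthogonal to the axis; each such
  half-plane contains exactly one.\<close>

definition half_plane_angle :: "(real^3) set \<Rightarrow> (real^3) set \<Rightarrow> real" where
  "half_plane_angle H K = (THE \<theta>. \<exists>v\<in>H. \<exists>w\<in>K. v $ 3 = 0 \<and> w $ 3 = 0 \<and> norm v = 1 \<and> norm w = 1 \<and>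
     \<theta> = arccos (v \<bullet> w))"

text \<open>The length of a path: the supremum of the lengths of inscribed polygons, possibly
  infinite. Each sorted list of parameters gives a polygon.\<close>

definition path_length :: "(real \<Rightarrow> 'a::metric_space) \<Rightarrow> ennreal" where
  "path_length g = (SUP ts \<in> {ts. sorted ts \<and> set ts \<subseteq> {0..1}}.
     \<Sum>i<length ts - 1. ennreal (dist (g (ts ! i)) (g (ts ! Suc i))))"

definition path_from_to :: "'a::metric_space set \<Rightarrow> 'a \<Rightarrow> 'a \<Rightarrow> (real \<Rightarrow> 'a) \<Rightarrow> bool" where
  "path_from_to X P Q g \<longleftrightarrow>
     path g \<and> path_image g \<subseteq> X \<and> pathstart g = P \<and> pathfinish g = Q"

text \<open>With \<open>X = side h\<close> these are the classical minimal geodesics on the side, with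
  \<open>X = soup_can h\<close> the minimal paths on the can.\<close>

definition minimal_path :: "'a::metric_space set \<Rightarrow> 'a \<Rightarrow> 'a \<Rightarrow> (real \<Rightarrow> 'a) \<Rightarrow> bool" where
  "minimal_path X P Q g \<longleftrightarrow>
     path_from_to X P Q g \<and> (\<forall>g'. path_from_to X P Q g' \<longrightarrow> path_length g \<le> path_length g')"

text \<open>\<open>crossing h k \<theta> A B t u \<beta>\<close>: the path \<open>\<beta>\<close> runs from \<open>A\<close> along a minimal geodesic on the side
  to the rim at height \<open>k\<close>, then along a chord of that rim, then along a minimal geodesic on the
  side to \<open>B\<close>. Here \<open>k = h\<close> is the crossing of the lid and \<open>k = 0\<close> that of the base.\<close>

definition crossing ::
    "real \<Rightarrow> real \<Rightarrow> real \<Rightarrow> real^3 \<Rightarrow> real^3 \<Rightarrow> real \<Rightarrow> real \<Rightarrow> (real \<Rightarrow> real^3) \<Rightarrow> bool" where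
  "crossing h k \<theta> A B t u \<beta> \<longleftrightarrow> (\<exists>\<gamma> \<gamma>'.
     minimal_path (side h) A (cyl 1 t k) \<gamma> \<and>
     minimal_path (side h) (cyl 1 (\<theta> - u) k) B \<gamma>' \<and>
     \<beta> = \<gamma> +++ (linepath (cyl 1 t k) (cyl 1 (\<theta> - u) k) +++ \<gamma>'))"

definition minimal_crossing ::
    "real \<Rightarrow> real \<Rightarrow> real \<Rightarrow> real^3 \<Rightarrow> real^3 \<Rightarrow> (real \<Rightarrow> real^3) \<Rightarrow> bool" where
  "minimal_crossing h k \<theta> A B \<beta> \<longleftrightarrow>
     (\<exists>t\<in>{0..\<theta>}. \<exists>u\<in>{0..\<theta>}. crossing h k \<theta> A B t u \<beta>) \<and>
     (\<forall>t\<in>{0..\<theta>}. \<forall>u\<in>{0..\<theta>}. \<forall>\<beta>'. crossing h k \<theta> A B t u \<beta>' \<longrightarrow> path_length \<beta> \<le> path_length \<beta>')"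

lemma cyl_nth [simp]:
  "cyl r \<phi> z $ 1 = r * cos \<phi>" "cyl r \<phi> z $ 2 = r * sin \<phi>" "cyl r \<phi> z $ 3 = z"
  by (simp_all add: cyl_def vector_3)

lemma half_plane_angle_cyl:
  "half_plane_angle (half_plane (cyl 1 \<alpha> y)) (half_plane (cyl 1 \<beta> z)) = arccos (cos (\<beta> - \<alpha>))"
proof -
  have unit: "v \<in> half_plane (cyl 1 \<phi> x) \<and> v $ 3 = 0 \<and> norm v = 1 \<longleftrightarrow> v = cyl 1 \<phi> 0" for v \<phi> x
  proof
    assume v: "v \<in> half_plane (cyl 1 \<phi> x) \<and> v $ 3 = 0 \<and> norm v = 1"
    then obtain s where s: "0 \<le> s" "v $ 1 = s * cos \<phi>" "v $ 2 = s * sin \<phi>"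
      by (auto simp: half_plane_def vector_3)
    have "(norm v)\<^sup>2 = (v $ 1)\<^sup>2 + (v $ 2)\<^sup>2 + (v $ 3)\<^sup>2"
      unfolding power2_norm_eq_inner by (simp add: inner_vec_def sum_3 power2_eq_square)
    also have "\<dots> = (s * cos \<phi>)\<^sup>2 + (s * sin \<phi>)\<^sup>2"
      using v s by simp
    also have "\<dots> = s\<^sup>2 * ((cos \<phi>)\<^sup>2 + (sin \<phi>)\<^sup>2)"
      by (simp only: power_mult_distrib distrib_left)
    finally have "s = 1"
      using v s(1) by (simp add: power2_eq_1_iff)
    then show "v = cyl 1 \<phi> 0"
      using v s by (simp add: vec_eq_iff forall_3)
  next
    assume v: "v = cyl 1 \<phi> 0"
    have "(norm v)\<^sup>2 = 1"
      by (simp add: v power2_norm_eq_inner inner_vec_def sum_3 flip: power2_eq_square)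
    then have "norm v = 1"
      by (metis norm_ge_zero power2_eq_1_iff abs_norm_cancel abs_minus_cancel abs_one)
    moreover have "v \<in> half_plane (cyl 1 \<phi> x)"
      unfolding half_plane_def v by (intro CollectI exI[of _ 1] exI[of _ 0]) (simp add: cyl_def vector_3)
    ultimately show "v \<in> half_plane (cyl 1 \<phi> x) \<and> v $ 3 = 0 \<and> norm v = 1"
      by (simp add: v)
  qed
  have ip: "cyl 1 \<alpha> 0 \<bullet> cyl 1 \<beta> 0 = cos (\<beta> - \<alpha>)"
    by (simp add: inner_vec_def sum_3 cos_diff mult.commute)
  show ?thesis
    unfolding half_plane_angle_def
    by (rule the_equality) (use unit ip in metis)+
qed

text \<open>Any two points of the side can be brought, by an isometry of space that preserves the can,
  into a position in which their angular coordinates are \<open>0\<close> and the angle between their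
  half-planes.\<close>

lemma positioning:
  assumes "A \<in> side h" "B \<in> side h"
  defines "\<theta> \<equiv> half_plane_angle (half_plane A) (half_plane B)"
  obtains F where
    "orthogonal_transformation F" "F ` side h = side h" "F ` lid h = lid h" "F ` base = base"
    "F A = cyl 1 0 (F A $ 3)" "F B = cyl 1 \<theta> (F B $ 3)" "\<theta> \<in> {0..pi}"
    "\<theta> = half_plane_angle (half_plane (F A)) (half_plane (F B))"
proof -
  obtain \<alpha> \<beta> y z where A: "A = cyl 1 \<alpha> y" and B: "B = cyl 1 \<beta> z"
    using assms(1,2) by (auto simp: side_def)
  have \<theta>: "\<theta> = arccos (cos (\<beta> - \<alpha>))"
    by (simp add: \<theta>_def A B half_plane_angle_cyl)
  define e :: real where "e = (if 0 \<le> sin (\<beta> - \<alpha>) then 1 else - 1)"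
  have e: "e = 1 \<or> e = - 1"
    by (simp add: e_def)
  then have ee: "e * e = 1"
    by auto
  define F :: "real^3 \<Rightarrow> real^3" where
    "F v = vector [v $ 1 * cos \<alpha> + v $ 2 * sin \<alpha>, e * (v $ 2 * cos \<alpha> - v $ 1 * sin \<alpha>), v $ 3]" for v
  have Fnth: "F v $ 1 = v $ 1 * cos \<alpha> + v $ 2 * sin \<alpha>"
    "F v $ 2 = e * (v $ 2 * cos \<alpha> - v $ 1 * sin \<alpha>)" "F v $ 3 = v $ 3" for v
    by (simp_all add: F_def vector_3)
  have lin: "linear F"
    by (rule linearI) (simp_all add: vec_eq_iff forall_3 Fnth algebra_simps)
  have inner: "F v \<bullet> F w = v \<bullet> w" for v w
  proof -
    have "F v \<bullet> F w = (v $ 1 * w $ 1 + v $ 2 * w $ 2) * ((sin \<alpha>)\<^sup>2 + (cos \<alpha>)\<^sup>2) + v $ 3 * w $ 3"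
      using e by (auto simp: inner_vec_def sum_3 Fnth power2_eq_square algebra_simps
          simp del: sin_cos_squared_add sin_cos_squared_add2 sin_cos_squared_add3)
    then show ?thesis
      by (simp add: inner_vec_def sum_3)
  qed
  have Fcyl: "F (cyl r \<phi> x) = cyl r (e * (\<phi> - \<alpha>)) x" for r \<phi> x
    using e by (auto simp: vec_eq_iff forall_3 Fnth cos_diff sin_diff algebra_simps)
  have cylF: "cyl r \<phi> x = F (cyl r (\<alpha> + e * \<phi>) x)" for r \<phi> x
    by (simp add: Fcyl ee flip: mult.assoc)
  have img: "F ` {cyl r \<phi> x | r \<phi> x. Q r x} = {cyl r \<phi> x | r \<phi> x. Q r x}" for Q
  proof (intro equalityI subsetI)
    fix v assume "v \<in> F ` {cyl r \<phi> x | r \<phi> x. Q r x}"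
    then show "v \<in> {cyl r \<phi> x | r \<phi> x. Q r x}"
      using Fcyl by fastforce
  next
    fix v assume "v \<in> {cyl r \<phi> x | r \<phi> x. Q r x}"
    then show "v \<in> F ` {cyl r \<phi> x | r \<phi> x. Q r x}"
      using cylF by blast
  qed
  have cos_\<theta>: "cos \<theta> = cos (\<beta> - \<alpha>)"
    by (simp add: \<theta>)
  have \<theta>_range: "\<theta> \<in> {0..pi}"
    by (simp add: \<theta> arccos_lbound arccos_ubound)
  have "\<bar>sin \<theta>\<bar> = \<bar>sin (\<beta> - \<alpha>)\<bar>"
    by (metis cos_\<theta> sin_squared_eq power2_eq_iff abs_minus_cancel)
  then have sin_\<theta>: "sin \<theta> = e * sin (\<beta> - \<alpha>)"
    using \<theta>_range sin_ge_zero[of \<theta>] by (auto simp: e_def)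
  have FA: "F A = cyl 1 0 y"
    by (simp add: A Fcyl)
  have FB: "F B = cyl 1 \<theta> z"
    using e by (auto simp: B Fcyl vec_eq_iff forall_3 cos_\<theta> sin_\<theta> cos_diff sin_diff)
  show thesis
  proof
    show "orthogonal_transformation F"
      using lin inner by (simp add: orthogonal_transformation_def)
    show "F ` side h = side h"
      using img[of "\<lambda>r x. r = 1 \<and> 0 \<le> x \<and> x \<le> h"] by (simp add: side_def)
    show "F ` lid h = lid h"
      using img[of "\<lambda>r x. 0 \<le> r \<and> r \<le> 1 \<and> x = h"] by (simp add: lid_def)
    show "F ` base = base"
      using img[of "\<lambda>r x. 0 \<le> r \<and> r \<le> 1 \<and> x = 0"] by (simp add: base_def)
    show "F A = cyl 1 0 (F A $ 3)" "F B = cyl 1 \<theta> (F B $ 3)"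
      by (simp_all add: FA FB)
    show "\<theta> \<in> {0..pi}"
      by (rule \<theta>_range)
    show "\<theta> = half_plane_angle (half_plane (F A)) (half_plane (F B))"
      using \<theta>_range by (simp add: FA FB half_plane_angle_cyl arccos_cos)
  qed
qed

end

(*
A path that meets the lid splits at its first and last visit to the lid into an initial part, a
middle part that is at least as long as the chord between the two rim points, and a final part.
The outer parts live on the side and the base and split in the same way; a part on the side can be
lifted to the strip that unrolls the cylinder, where straight segments are shortest.
All the pieces are measured by the angle through which they turn. Chords can be rotated about the
axis, and the chord over an angle is subadditive in that angle, so all chords can be collected
into a single one across the lid. This bounds the length of the path below by that of a crossing of
the lid, with signed turns t and u that may be out of range; such turns are replaced by better ones
or lose against the geodesic on the side. Paths that miss the lid but meet the base are treated
alike.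
*)
theory Submission
  imports Defs
begin

subsection \<open>Length of a curve over an interval\<close>

text \<open>The sum in \<open>path_length\<close> in recursive form, so that facts about polygons
  follow by induction on the list.\<close>

fun polygon_length :: "(real \<Rightarrow> 'a::metric_space) \<Rightarrow> real list \<Rightarrow> ennreal" where
  "polygon_length g (x # y # ts) = ennreal (dist (g x) (g y)) + polygon_length g (y # ts)"
| "polygon_length g _ = 0"

text \<open>Arbitrary parameter intervals allow a path to be cut at a point without reparametrizing
  its pieces.\<close>

definition curve_length :: "(real \<Rightarrow> 'a::metric_space) \<Rightarrow> real \<Rightarrow> real \<Rightarrow> ennreal" where
  "curve_length g a b = (SUP ts \<in> {ts. sorted ts \<and> set ts \<subseteq> {a..b}}. polygon_length g ts)"

lemma polygon_length_eq_sum: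
  "polygon_length g ts = (\<Sum>i<length ts - 1. ennreal (dist (g (ts ! i)) (g (ts ! Suc i))))"
proof (induction g ts rule: polygon_length.induct)
  case (1 g x y ts)
  then show ?case
    by (simp add: sum.lessThan_Suc_shift del: sum.lessThan_Suc)
qed auto

lemma path_length_eq_curve_length: "path_length g = curve_length g 0 1"
  unfolding path_length_def curve_length_def polygon_length_eq_sum ..

lemma polygon_length_le_curve_length:
  "sorted ts \<Longrightarrow> set ts \<subseteq> {a..b} \<Longrightarrow> polygon_length g ts \<le> curve_length g a b"
  unfolding curve_length_def by (rule SUP_upper) simp

lemma curve_length_le:
  assumes "\<And>ts. sorted ts \<Longrightarrow> set ts \<subseteq> {a..b} \<Longrightarrow> polygon_length g ts \<le> C"
  shows "curve_length g a b \<le> C"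
  unfolding curve_length_def by (rule SUP_least) (use assms in auto)

lemma dist_le_curve_length:
  assumes "a \<le> b"
  shows "ennreal (dist (g a) (g b)) \<le> curve_length g a b"
  using polygon_length_le_curve_length[of "[a, b]" a b g] assms by simp

lemma polygon_length_append:
  "polygon_length g xs + polygon_length g ys \<le> polygon_length g (xs @ ys)"
proof (induction g xs rule: polygon_length.induct)
  case ("2_2" g v)
  then show ?case by (cases ys) auto
qed (auto simp: add.assoc intro: add_left_mono)

text \<open>Routing through \<open>c\<close> replaces at most one edge by two, at no loss by the
  triangle inequality.\<close>

lemma polygon_length_insert:
  "polygon_length g (xs @ ys) \<le> polygon_length g (xs @ [c]) + polygon_length g (c # ys)"
proof (induction g xs rule: polygon_length.induct)
  case ("2_1" g)
  then show ?case by (cases ys) auto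
next
  case ("2_2" g v)
  show ?case
  proof (cases ys)
    case (Cons y zs)
    have "ennreal (dist (g v) (g y)) \<le> ennreal (dist (g v) (g c)) + ennreal (dist (g c) (g y))"
      by (simp add: dist_triangle flip: ennreal_plus)
    then show ?thesis
      by (simp add: Cons add_right_mono flip: add.assoc)
  qed simp
qed (auto simp: add.assoc intro: add_left_mono)

text \<open>For the upper bound each polygon is cut at \<open>c\<close>, with \<open>c\<close> added
  as a vertex; for the lower bound polygons from both sides are concatenated.\<close>

lemma curve_length_split:
  assumes "a \<le> c" "c \<le> b"
  shows "curve_length g a b = curve_length g a c + curve_length g c b"
proof (rule antisym)
  show "curve_length g a b \<le> curve_length g a c + curve_length g c b"
  proof (rule curve_length_le)
    fix ts :: "real list" assume ts: "sorted ts" "set ts \<subseteq> {a..b}"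
    let ?xs = "takeWhile (\<lambda>x. x \<le> c) ts" and ?ys = "dropWhile (\<lambda>x. x \<le> c) ts"
    have xs: "sorted (?xs @ [c])" "set (?xs @ [c]) \<subseteq> {a..c}"
      using ts assms by (auto simp: sorted_append dest!: set_takeWhileD)
    \<comment> \<open>The list is sorted, so all that \<open>dropWhile\<close> leaves is at least
      its head, which exceeds \<open>c\<close>.\<close>
    have big: "c \<le> y" if "y \<in> set ?ys" for y
    proof (cases ?ys)
      case Nil
      show ?thesis
        using that unfolding Nil by simp
    next
      case (Cons z zs)
      then have "\<not> z \<le> c"
        using hd_dropWhile[of "\<lambda>x. x \<le> c" ts] by simp
      moreover have "z \<le> y"
        using sorted_wrt_dropWhile[OF ts(1), of "\<lambda>x. x \<le> c"] that unfolding Cons by auto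
      ultimately show ?thesis by simp
    qed
    have "y \<le> b" if "y \<in> set ?ys" for y
      using set_dropWhileD[OF that] ts(2) by auto
    then have ys: "sorted (c # ?ys)" "set (c # ?ys) \<subseteq> {c..b}"
      using ts(1) assms big by auto
    have "polygon_length g ts \<le> polygon_length g (?xs @ [c]) + polygon_length g (c # ?ys)"
      using polygon_length_insert[of g ?xs ?ys c] by simp
    also have "\<dots> \<le> curve_length g a c + curve_length g c b"
      by (intro add_mono polygon_length_le_curve_length xs ys)
    finally show "polygon_length g ts \<le> curve_length g a c + curve_length g c b" .
  qed
  let ?S = "\<lambda>a b. {ts. sorted ts \<and> set ts \<subseteq> {a..b::real}}"
  \<comment> \<open>The rules that pull a constant summand out of a supremum ask for a nonempty
    index set; the empty list is a member of both.\<close>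
  have ne: "?S a c \<noteq> {}" "?S c b \<noteq> {}"
    by (auto intro!: exI[of _ "[]"])
  have *: "polygon_length g xs + polygon_length g ys \<le> curve_length g a b"
    if "xs \<in> ?S a c" "ys \<in> ?S c b" for xs ys
  proof -
    have "sorted (xs @ ys)" "set (xs @ ys) \<subseteq> {a..b}"
      using that assms by (fastforce simp: sorted_append)+
    then show ?thesis
      using polygon_length_append polygon_length_le_curve_length order_trans by blast
  qed
  have "(SUP ys \<in> ?S c b. polygon_length g xs + polygon_length g ys) \<le> curve_length g a b"
    if "xs \<in> ?S a c" for xs
    by (rule SUP_least) (rule *[OF that])
  then have "polygon_length g xs + curve_length g c b \<le> curve_length g a b"
    if "xs \<in> ?S a c" for xs
    using that ne(2) unfolding curve_length_def[of g c b] by (simp add: ennreal_SUP_add_right)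
  then have "(SUP xs \<in> ?S a c. polygon_length g xs + curve_length g c b) \<le> curve_length g a b"
    by (intro SUP_least)
  then show "curve_length g a c + curve_length g c b \<le> curve_length g a b"
    using ne(1) unfolding curve_length_def[of g a c] by (simp add: ennreal_SUP_add_left)
qed

lemma polygon_length_map: "polygon_length g (map f ts) = polygon_length (\<lambda>x. g (f x)) ts"
  by (induction "\<lambda>x. g (f x)" ts rule: polygon_length.induct) auto

lemma polygon_length_cong:
  "(\<And>x. x \<in> set ts \<Longrightarrow> g x = g' x) \<Longrightarrow> polygon_length g ts = polygon_length g' ts"
  by (induction g ts rule: polygon_length.induct) auto

lemma curve_length_cong:
  assumes "\<And>x. a \<le> x \<Longrightarrow> x \<le> b \<Longrightarrow> g x = g' x"
  shows "curve_length g a b = curve_length g' a b"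
proof -
  have "polygon_length g ts = polygon_length g' ts" if "set ts \<subseteq> {a..b}" for ts
    by (rule polygon_length_cong) (use that assms in auto)
  then show ?thesis
    unfolding curve_length_def by auto
qed

text \<open>A monotone map sends sorted lists of parameters to sorted lists, so polygons inscribed
  in the composite are inscribed in \<open>g\<close>.\<close>

lemma curve_length_reparam_le:
  assumes "mono f"
  shows "curve_length (\<lambda>x. g (f x)) a b \<le> curve_length g (f a) (f b)"
proof (rule curve_length_le)
  fix ts :: "real list" assume ts: "sorted ts" "set ts \<subseteq> {a..b}"
  have "sorted (map f ts)"
    using ts(1) assms by (auto intro!: sorted_map_mono mono_onI dest: monoD)
  moreover have "f x \<in> {f a..f b}" if "x \<in> set ts" for x
    using monoD[OF assms, of a x] monoD[OF assms, of x b] ts(2) that by auto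
  then have "set (map f ts) \<subseteq> {f a..f b}"
    by auto
  ultimately show "polygon_length (\<lambda>x. g (f x)) ts \<le> curve_length g (f a) (f b)"
    unfolding polygon_length_map[symmetric] by (rule polygon_length_le_curve_length)
qed

lemma curve_length_affine:
  assumes "0 < m"
  shows "curve_length (\<lambda>x. g (m * x + c)) a b = curve_length g (m * a + c) (m * b + c)"
proof (rule antisym)
  have "mono (\<lambda>x. m * x + c)" "mono (\<lambda>x. (x - c) / m)"
    using assms by (auto simp: mono_def divide_right_mono)
  note mono = this[THEN curve_length_reparam_le]
  show "curve_length (\<lambda>x. g (m * x + c)) a b \<le> curve_length g (m * a + c) (m * b + c)"
    by (rule mono(1))
  show "curve_length g (m * a + c) (m * b + c) \<le> curve_length (\<lambda>x. g (m * x + c)) a b"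
    using mono(2)[of "\<lambda>x. g (m * x + c)" "m * a + c" "m * b + c"] assms by simp
qed

lemma path_length_join:
  assumes "pathfinish g = pathstart g'"
  shows "path_length (g +++ g') = path_length g + path_length g'"
proof -
  have "curve_length (g +++ g') 0 (1/2) = curve_length (\<lambda>x. g (2 * x + 0)) 0 (1/2)"
    by (rule curve_length_cong) (auto simp: joinpaths_def)
  moreover have "curve_length (g +++ g') (1/2) 1 = curve_length (\<lambda>x. g' (2 * x + (-1))) (1/2) 1"
  proof (rule curve_length_cong)
    fix x :: real assume "1/2 \<le> x" "x \<le> 1"
    \<comment> \<open>At \<open>1/2\<close> the join follows the first path; the matching endpoints
      make the formula of the second valid there too.\<close>
    then consider "x = 1/2" | "1/2 < x" by force
    then show "(g +++ g') x = g' (2 * x + (-1))"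
    proof cases
      case 1
      show ?thesis
        using assms unfolding 1 by (simp add: joinpaths_def pathstart_def pathfinish_def)
    qed (simp add: joinpaths_def)
  qed
  ultimately show ?thesis
    unfolding path_length_eq_curve_length
    using curve_length_split[of 0 "1/2" 1 "g +++ g'"] curve_length_affine[of 2 g 0 0 "1/2"]
      curve_length_affine[of 2 g' "-1" "1/2" 1] by simp
qed

section \<open>Upper and lower bounds for lengths\<close>

lemma curve_length_le_Lipschitz:
  assumes "\<And>x y. x \<in> {a..b} \<Longrightarrow> y \<in> {a..b} \<Longrightarrow> x \<le> y \<Longrightarrow> dist (g x) (g y) \<le> C * (y - x)"
    and "0 \<le> C" "a \<le> b"
  shows "curve_length g a b \<le> ennreal (C * (b - a))"
proof (rule curve_length_le)
  fix ts :: "real list" assume ts: "sorted ts" "set ts \<subseteq> {a..b}"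
  \<comment> \<open>The bound starts at the first parameter, not at \<open>a\<close>, so that the
    induction survives the removal of the head.\<close>
  have "polygon_length g ts \<le> ennreal (C * (b - hd ts))" if "ts \<noteq> []"
    using ts that assms(1)
  proof (induction g ts rule: polygon_length.induct)
    case (1 g x y ts)
    have "polygon_length g (x # y # ts) \<le> ennreal (C * (y - x)) + ennreal (C * (b - y))"
      using 1 by (auto intro!: add_mono ennreal_leI)
    also have "\<dots> = ennreal (C * (y - x) + C * (b - y))"
      using 1 assms by (subst ennreal_plus) auto
    finally show ?case
      by (simp add: algebra_simps)
  qed auto
  moreover have "ennreal (C * (b - hd ts)) \<le> ennreal (C * (b - a))" if "ts \<noteq> []"
    using that ts assms by (intro ennreal_leI mult_left_mono) (auto dest: hd_in_set)
  ultimately show "polygon_length g ts \<le> ennreal (C * (b - a))"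
    by (cases "ts = []") (auto dest: order_trans)
qed

lemma path_length_linepath: "path_length (linepath p q) = ennreal (dist p q)"
proof (rule antisym)
  have "dist (linepath p q x) (linepath p q y) = dist p q * (y - x)" if "x \<le> y" for x y
  proof -
    have "linepath p q x - linepath p q y = (y - x) *\<^sub>R (p - q)"
      by (simp add: linepath_def algebra_simps)
    then show ?thesis
      using that by (simp add: dist_norm)
  qed
  then show "path_length (linepath p q) \<le> ennreal (dist p q)"
    using curve_length_le_Lipschitz[of 0 1 "linepath p q" "dist p q"]
    by (simp add: path_length_eq_curve_length)
  show "ennreal (dist p q) \<le> path_length (linepath p q)"
    using dist_le_curve_length[of 0 1 "linepath p q"]
    by (simp add: path_length_eq_curve_length linepath_def)
qed

text \<open>Refining to mesh $1/n$ makes the local comparison of the hypothesis available on every edge.\<close>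

lemma curve_length_ge_local:
  fixes g :: "real \<Rightarrow> 'a::metric_space" and f :: "real \<Rightarrow> 'b::metric_space"
  assumes "a \<le> b" "0 \<le> c" "0 < \<delta>"
    and local: "\<And>x y. x \<in> {a..b} \<Longrightarrow> y \<in> {a..b} \<Longrightarrow> dist x y < \<delta> \<Longrightarrow>
      c * dist (f x) (f y) \<le> dist (g x) (g y)"
  shows "ennreal (c * dist (f a) (f b)) \<le> curve_length g a b"
proof -
  obtain n where n: "(b - a) / \<delta> < real n"
    using reals_Archimedean2 by blast
  with assms have npos: "0 < n"
    by (smt (verit) divide_nonneg_pos of_nat_0_less_iff)
  define s where "s i = a + (b - a) / n * real i" for i
  have s: "s 0 = a" "s n = b"
    using npos by (auto simp: s_def)
  have step: "s (Suc i) - s i = (b - a) / n" for i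
    using npos by (simp add: s_def field_simps)
  have small: "(b - a) / n < \<delta>"
    using n npos assms by (simp add: field_simps)
  have mono: "s i \<le> s j" if "i \<le> j" for i j
    using that assms by (auto simp: s_def intro!: mult_left_mono divide_right_mono)
  have in_ab: "s i \<in> {a..b}" if "i \<le> n" for i
    using mono[of 0 i] mono[of i n] that s by auto
  have *: "ennreal (c * dist (f a) (f (s k))) \<le> curve_length g a (s k)" if "k \<le> n" for k
    using that
  proof (induction k)
    case (Suc k)
    have "c * dist (f a) (f (s (Suc k))) \<le> c * (dist (f a) (f (s k)) + dist (f (s k)) (f (s (Suc k))))"
      using assms by (intro mult_left_mono dist_triangle)
    also have "\<dots> \<le> c * dist (f a) (f (s k)) + dist (g (s k)) (g (s (Suc k)))"
      using local[of "s k" "s (Suc k)"] in_ab[of k] in_ab[of "Suc k"] Suc.prems step[of k] small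
        mono[of k "Suc k"]
      by (simp add: dist_real_def algebra_simps)
    finally have "ennreal (c * dist (f a) (f (s (Suc k))))
        \<le> ennreal (c * dist (f a) (f (s k))) + ennreal (dist (g (s k)) (g (s (Suc k))))"
      using assms by (simp add: ennreal_leI flip: ennreal_plus)
    also have "\<dots> \<le> curve_length g a (s k) + curve_length g (s k) (s (Suc k))"
      using Suc mono[of k "Suc k"] by (intro add_mono dist_le_curve_length) auto
    also have "\<dots> = curve_length g a (s (Suc k))"
      using mono[of 0 k] mono[of k "Suc k"] s by (intro curve_length_split[symmetric]) auto
    finally show ?case .
  qed (simp add: s)
  show ?thesis
    using *[of n] s by simp
qed

subsection \<open>Curves on the can\<close>

text \<open>The length of the chord of the unit circle over the angle \<open>v\<close>. Every real
  \<open>v\<close> is allowed, since turns are signed and may wind around the axis.\<close>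

definition chord :: "real \<Rightarrow> real" where
  "chord v = sqrt (2 - 2 * cos v)"

lemma cyl_1_eq_iff: "cyl 1 x z = cyl 1 y w \<longleftrightarrow> cos x = cos y \<and> sin x = sin y \<and> z = w"
  by (auto simp: vec_eq_iff forall_3)

lemma chord_power2: "(chord v)\<^sup>2 = 2 - 2 * cos v"
  by (simp add: chord_def)

lemma chord_eq_sin: "chord v = 2 * \<bar>sin (v / 2)\<bar>"
proof -
  have "2 - 2 * cos v = (2 * sin (v / 2))\<^sup>2"
    using cos_double_sin[of "v / 2"] by (simp add: power_mult_distrib)
  then show ?thesis
    unfolding chord_def by (metis real_sqrt_abs abs_mult abs_numeral)
qed

lemma chord_nonneg: "0 \<le> chord v"
  by (simp add: chord_eq_sin)

lemma chord_le: "chord v \<le> \<bar>v\<bar>"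
  using abs_sin_x_le_abs_x[of "v / 2"] by (simp add: chord_eq_sin)

text \<open>Pythagoras: the vertical difference is orthogonal to the horizontal chord.\<close>

lemma dist_cyl: "dist (cyl 1 x z) (cyl 1 y w) = sqrt ((w - z)\<^sup>2 + (chord (y - x))\<^sup>2)"
proof -
  have "(cyl 1 x z - cyl 1 y w) \<bullet> (cyl 1 x z - cyl 1 y w)
      = (cos x - cos y)\<^sup>2 + (sin x - sin y)\<^sup>2 + (z - w)\<^sup>2"
    by (simp add: inner_vec_def sum_3 power2_eq_square)
  also have "\<dots> = (w - z)\<^sup>2 + ((sin x)\<^sup>2 + (cos x)\<^sup>2) + ((sin y)\<^sup>2 + (cos y)\<^sup>2) - 2 * cos (y - x)"
    by (simp add: cos_diff power2_eq_square algebra_simps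
        del: sin_cos_squared_add sin_cos_squared_add2 sin_cos_squared_add3)
  finally show ?thesis
    by (simp add: dist_norm norm_eq_sqrt_inner chord_power2)
qed

lemma dist_cyl_same_height: "dist (cyl 1 x z) (cyl 1 y z) = chord (y - x)"
  by (simp add: dist_cyl chord_nonneg)

text \<open>The triangle inequality for the points at angles \<open>0\<close>, \<open>v\<close> and
  \<open>v + w\<close> of the unit circle. It serves to merge several cap crossings into
  one.\<close>

lemma chord_add_le: "chord (v + w) \<le> chord v + chord w"
  using dist_triangle[of "cyl 1 0 0" "cyl 1 (v + w) 0" "cyl 1 v 0"]
  by (simp add: dist_cyl_same_height)

lemma dist_cyl_le: "dist (cyl 1 x z) (cyl 1 y w) \<le> sqrt ((w - z)\<^sup>2 + (y - x)\<^sup>2)"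
  unfolding dist_cyl using chord_le[of "y - x"] chord_nonneg[of "y - x"]
  by (simp add: abs_le_square_iff[symmetric])

text \<open>Short chords are almost as long as their arcs, because \<open>sin x / x\<close> tends to
  1; the factor \<open>c\<close> absorbs the difference.\<close>

lemma chord_ge_near_0:
  assumes "c < 1"
  obtains \<delta> where "0 < \<delta>" "\<And>v. \<bar>v\<bar> < \<delta> \<Longrightarrow> c * \<bar>v\<bar> \<le> chord v"
proof -
  have "((\<lambda>x::real. sin x / x) \<longlongrightarrow> 1) (at 0)"
    using DERIV_sin[of "0::real"] by (simp add: DERIV_def)
  then have "eventually (\<lambda>x::real. c < sin x / x) (at 0)"
    by (rule order_tendstoD) (rule assms)
  then obtain \<delta> where \<delta>: "0 < \<delta>" "\<And>x::real. x \<noteq> 0 \<Longrightarrow> \<bar>x\<bar> < \<delta> \<Longrightarrow> c < sin x / x"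
    by (auto simp: eventually_at dist_real_def)
  show thesis
  proof
    \<comment> \<open>The chord over \<open>v\<close> involves the sine of \<open>v / 2\<close>,
      hence the doubled radius.\<close>
    show "0 < 2 * \<delta>"
      using \<delta> by simp
    fix v :: real assume v: "\<bar>v\<bar> < 2 * \<delta>"
    show "c * \<bar>v\<bar> \<le> chord v"
    proof (cases "v = 0")
      case False
      with v have "c < sin (v / 2) / (v / 2)"
        by (intro \<delta>) auto
      also have "\<dots> \<le> \<bar>sin (v / 2)\<bar> / \<bar>v / 2\<bar>"
        by (metis abs_divide abs_ge_self)
      finally show ?thesis
        using False by (simp add: chord_eq_sin field_simps)
    qed (simp add: chord_nonneg)
  qed
qed

section \<open>The pieces of the can as closed sets\<close>

lemma side_eq: "side h = {v. (v $ 1)\<^sup>2 + (v $ 2)\<^sup>2 = 1 \<and> 0 \<le> v $ 3 \<and> v $ 3 \<le> h}"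
proof (intro set_eqI iffI)
  fix v :: "real^3"
  assume v: "v \<in> {v. (v $ 1)\<^sup>2 + (v $ 2)\<^sup>2 = 1 \<and> 0 \<le> v $ 3 \<and> v $ 3 \<le> h}"
  then obtain \<phi> where "v $ 1 = cos \<phi>" "v $ 2 = sin \<phi>"
    using sincos_total_2pi[of "v $ 1" "v $ 2"] by blast
  then have "v = cyl 1 \<phi> (v $ 3)"
    by (simp add: vec_eq_iff forall_3)
  with v show "v \<in> side h"
    by (auto simp: side_def)
qed (auto simp: side_def)

lemma lid_eq: "lid h = {v. (v $ 1)\<^sup>2 + (v $ 2)\<^sup>2 \<le> 1 \<and> v $ 3 = h}"
proof (intro set_eqI iffI)
  fix v :: "real^3"
  assume "v \<in> lid h"
  then obtain r \<phi> where v: "v = cyl r \<phi> h" "0 \<le> r" "r \<le> 1"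
    by (auto simp: lid_def)
  have "(v $ 1)\<^sup>2 + (v $ 2)\<^sup>2 = r\<^sup>2 * ((sin \<phi>)\<^sup>2 + (cos \<phi>)\<^sup>2)"
    by (simp add: v power_mult_distrib algebra_simps
        del: sin_cos_squared_add sin_cos_squared_add2 sin_cos_squared_add3)
  also have "\<dots> \<le> 1"
    using v by (simp add: power_le_one)
  finally show "v \<in> {v. (v $ 1)\<^sup>2 + (v $ 2)\<^sup>2 \<le> 1 \<and> v $ 3 = h}"
    by (simp add: v)
next
  fix v :: "real^3"
  assume v: "v \<in> {v. (v $ 1)\<^sup>2 + (v $ 2)\<^sup>2 \<le> 1 \<and> v $ 3 = h}"
  \<comment> \<open>Polar coordinates come from the complex plane; at the centre \<open>Arg\<close>
    still yields some angle.\<close>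
  define c r \<phi> where "c = Complex (v $ 1) (v $ 2)" and "r = cmod c" and "\<phi> = Arg c"
  have "rcis r \<phi> = c"
    by (simp add: r_def \<phi>_def rcis_cmod_Arg)
  then have "v $ 1 = r * cos \<phi>" "v $ 2 = r * sin \<phi>"
    by (auto simp: c_def complex_eq_iff)
  then have "v = cyl r \<phi> h"
    using v by (simp add: vec_eq_iff forall_3)
  moreover have "0 \<le> r" "r \<le> 1"
    using v by (auto simp: r_def c_def norm_complex_def)
  ultimately show "v \<in> lid h"
    by (auto simp: lid_def)
qed

lemma base_eq: "base = lid 0"
  by (simp add: base_def lid_def)

lemma side_nth_3: "v \<in> side h \<Longrightarrow> 0 \<le> v $ 3 \<and> v $ 3 \<le> h"
  by (simp add: side_eq)

lemma in_sideE:
  assumes "v \<in> side h"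
  obtains \<phi> where "v = cyl 1 \<phi> (v $ 3)"
  using assms by (auto simp: side_def)

lemma closed_side: "closed (side h)"
  unfolding side_eq by (intro closed_Collect_conj closed_Collect_eq closed_Collect_le continuous_intros)

lemma closed_lid: "closed (lid h)"
  unfolding lid_eq by (intro closed_Collect_conj closed_Collect_eq closed_Collect_le continuous_intros)

lemma convex_lid: "convex (lid h)"
proof (rule convexI)
  fix v w :: "real^3" and s t :: real
  assume v: "v \<in> lid h" "w \<in> lid h" and st: "0 \<le> s" "0 \<le> t" "s + t = 1"
  define p where "p v = Complex (v $ 1) (v $ 2)" for v :: "real^3"
  have lid_p: "x \<in> lid h \<longleftrightarrow> norm (p x) \<le> 1 \<and> x $ 3 = h" for x
    by (simp add: lid_eq p_def norm_complex_def)
  have "p (s *\<^sub>R v + t *\<^sub>R w) = s *\<^sub>R p v + t *\<^sub>R p w"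
    by (simp add: p_def complex_eq_iff)
  moreover have "norm (s *\<^sub>R p v + t *\<^sub>R p w) \<le> 1"
    using convexD[OF convex_cball[of 0 1], of "p v" "p w" s t] v st by (simp add: lid_p)
  moreover have "s * h + t * h = h"
    using st by (simp flip: distrib_right)
  ultimately show "s *\<^sub>R v + t *\<^sub>R w \<in> lid h"
    using v by (simp add: lid_p)
qed

section \<open>Unrolling curves on the side\<close>

text \<open>The horizontal part is a nowhere vanishing complex function on a contractible interval
  and so has a continuous logarithm, whose imaginary part is the angle.\<close>

lemma side_curve_lift:
  fixes g :: "real \<Rightarrow> real^3"
  assumes "a \<le> b" "continuous_on {a..b} g" "g ` {a..b} \<subseteq> side h" "g a = cyl 1 \<phi> z"
  obtains p where "continuous_on {a..b} p" "p a = \<phi>" "\<And>s. s \<in> {a..b} \<Longrightarrow> g s = cyl 1 (p s) (g s $ 3)"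
proof -
  define f where "f s = Complex (g s $ 1) (g s $ 2)" for s
  have norm_f: "norm (f s) = 1" if "s \<in> {a..b}" for s
    using assms(3) that by (force simp: f_def norm_complex_def side_eq)
  have "continuous_on {a..b} f"
    unfolding f_def Complex_eq by (intro continuous_intros assms)
  moreover have "contractible {a..b}"
    by (intro convex_imp_contractible convex_real_interval)
  moreover have "f s \<noteq> 0" if "s \<in> {a..b}" for s
    using norm_f[OF that] by auto
  ultimately obtain l where l: "continuous_on {a..b} l" "\<And>s. s \<in> {a..b} \<Longrightarrow> f s = exp (l s)"
    using continuous_logarithm_on_contractible[of "{a..b}" f] by metis
  have Re_l: "Re (l s) = 0" if "s \<in> {a..b}" for s
    using norm_f[OF that] l(2)[OF that] by simp
  have g_l: "g s $ 1 = cos (Im (l s)) \<and> g s $ 2 = sin (Im (l s))" if "s \<in> {a..b}" for s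
    using l(2)[OF that] Re_l[OF that] by (simp add: f_def complex_eq_iff Re_exp Im_exp)
  \<comment> \<open>The logarithm fixes the angle only up to full turns; \<open>e\<close> is the
    multiple of \<open>2 * pi\<close> that moves its start to \<open>\<phi>\<close>.\<close>
  define e where "e = \<phi> - Im (l a)"
  have "cos \<phi> = cos (Im (l a))" "sin \<phi> = sin (Im (l a))"
    using g_l[of a] assms by auto
  then have e: "cos e = 1" "sin e = 0"
    by (simp_all add: e_def cos_diff sin_diff flip: power2_eq_square)
  show thesis
  proof
    show "continuous_on {a..b} (\<lambda>s. Im (l s) + e)"
      by (intro continuous_intros l)
    show "Im (l a) + e = \<phi>"
      by (simp add: e_def)
    show "g s = cyl 1 (Im (l s) + e) (g s $ 3)" if "s \<in> {a..b}" for s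
      using g_l[OF that] e by (simp add: vec_eq_iff forall_3 cos_add sin_add)
  qed
qed

text \<open>Heights and lifted angles trace the unrolled curve in the plane. For every
  \<open>c < 1\<close>, nearby points of \<open>g\<close> are at least \<open>c\<close> times as far
  apart as their plane counterparts; then \<open>c\<close> tends to 1. The total turn
  \<open>t\<close> may exceed a full circle.\<close>

lemma side_curve_length_ge:
  assumes "a \<le> b" "continuous_on {a..b} g" "g ` {a..b} \<subseteq> side h" "g a = cyl 1 \<phi> z"
  obtains t where "g b = cyl 1 (\<phi> + t) (g b $ 3)"
    "ennreal (sqrt ((g b $ 3 - z)\<^sup>2 + t\<^sup>2)) \<le> curve_length g a b"
proof -
  obtain p where p: "continuous_on {a..b} p" "p a = \<phi>" "\<And>s. s \<in> {a..b} \<Longrightarrow> g s = cyl 1 (p s) (g s $ 3)"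
    using side_curve_lift[OF assms] by blast
  define f where "f s = (g s $ 3, p s)" for s
  have *: "ennreal (c * dist (f a) (f b)) \<le> curve_length g a b" if c: "0 < c" "c < 1" for c
  proof -
    obtain e where e: "0 < e" "\<And>v. \<bar>v\<bar> < e \<Longrightarrow> c * \<bar>v\<bar> \<le> chord v"
      using chord_ge_near_0[OF c(2)] by blast
    have "uniformly_continuous_on {a..b} p"
      using p(1) by (simp add: compact_uniformly_continuous)
    then obtain \<delta> where \<delta>: "0 < \<delta>"
      "\<And>x y. x \<in> {a..b} \<Longrightarrow> y \<in> {a..b} \<Longrightarrow> dist x y < \<delta> \<Longrightarrow> dist (p x) (p y) < e"
      using e(1) unfolding uniformly_continuous_on_def by metis
    show ?thesis
    proof (rule curve_length_ge_local)
      fix x y assume xy: "x \<in> {a..b}" "y \<in> {a..b}" "dist x y < \<delta>"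
      have "c * \<bar>p y - p x\<bar> \<le> chord (p y - p x)"
        using \<delta>(2)[OF xy] by (intro e) (simp add: dist_real_def abs_minus_commute)
      then have "(c * \<bar>p y - p x\<bar>)\<^sup>2 \<le> (chord (p y - p x))\<^sup>2"
        using c by (intro power_mono) auto
      moreover have "(c * \<bar>g y $ 3 - g x $ 3\<bar>)\<^sup>2 \<le> \<bar>g y $ 3 - g x $ 3\<bar>\<^sup>2"
        using c by (intro power_mono) (auto simp: mult_left_le_one_le)
      ultimately have "(c * dist (f x) (f y))\<^sup>2 \<le> (g y $ 3 - g x $ 3)\<^sup>2 + (chord (p y - p x))\<^sup>2"
        by (simp add: f_def dist_prod_def dist_real_def power_mult_distrib distrib_left
            power2_commute[of "p x"] power2_commute[of "g x $ 3"])
      also have "\<dots> = (dist (cyl 1 (p x) (g x $ 3)) (cyl 1 (p y) (g y $ 3)))\<^sup>2"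
        by (simp add: dist_cyl)
      also have "\<dots> = (dist (g x) (g y))\<^sup>2"
        using p(3)[OF xy(1)] p(3)[OF xy(2)] by metis
      finally show "c * dist (f x) (f y) \<le> dist (g x) (g y)"
        by (rule power2_le_imp_le) simp
    qed (use assms c \<delta> in auto)
  qed
  \<comment> \<open>An infinite length needs no argument; a finite one permits the passage to the
    limit in \<open>c\<close>.\<close>
  have "ennreal (dist (f a) (f b)) \<le> curve_length g a b"
  proof (cases "curve_length g a b")
    case (real r)
    then have "c * dist (f a) (f b) \<le> r" if "0 < c" "c < 1" for c
      using *[OF that] by simp
    then show ?thesis
      using real field_le_mult_one_interval[of "dist (f a) (f b)" r] by simp
  qed simp
  moreover have "dist (f a) (f b) = sqrt ((g b $ 3 - z)\<^sup>2 + (p b - \<phi>)\<^sup>2)"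
    using assms p(2) by (simp add: f_def dist_prod_def dist_real_def power2_commute)
  ultimately show thesis
    using that[of "p b - \<phi>"] p(3)[of b] assms(1) by simp
qed

section \<open>Cutting a curve at its visits to a cap\<close>

text \<open>As \<open>D\<close> is closed there is a least parameter \<open>p\<close> with value in
  \<open>D\<close>. Before \<open>p\<close> the curve is confined to \<open>C\<close>, and
  closedness of \<open>C\<close> adds \<open>p\<close> itself.\<close>

lemma first_hit:
  fixes g :: "real \<Rightarrow> 'a::t2_space"
  assumes "continuous_on {a..b} g" "closed C" "closed D" "g ` {a..b} \<subseteq> C \<union> D"
    and "g a \<in> C" "s \<in> {a..b}" "g s \<in> D"
  obtains p where "a \<le> p" "p \<le> s" "g p \<in> D" "g ` {a..p} \<subseteq> C"
proof -
  have "closed ({a..b} \<inter> g -` D)"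
    using assms by (intro continuous_closed_preimage) auto
  then have "compact ({a..b} \<inter> ({a..b} \<inter> g -` D))"
    by (intro compact_Int_closed) auto
  moreover have "s \<in> {a..b} \<inter> ({a..b} \<inter> g -` D)"
    using assms by auto
  ultimately obtain p where p: "p \<in> {a..b}" "g p \<in> D" "\<And>q. q \<in> {a..b} \<Longrightarrow> g q \<in> D \<Longrightarrow> p \<le> q"
    using compact_attains_inf[of "{a..b} \<inter> ({a..b} \<inter> g -` D)"] by blast
  have "{a..p} \<subseteq> {a..b} \<inter> g -` C"
  proof (cases "p = a")
    case False
    with p have "a < p" by simp
    have "q \<in> {a..b} \<inter> g -` C" if q: "q \<in> {a..<p}" for q
    proof -
      have "q \<in> {a..b}" "g q \<notin> D"
        using q p(1) p(3)[of q] by auto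
      then show ?thesis
        using assms(4) by blast
    qed
    moreover have "closed ({a..b} \<inter> g -` C)"
      using assms by (intro continuous_closed_preimage) auto
    ultimately have "closure {a..<p} \<subseteq> {a..b} \<inter> g -` C"
      by (meson closure_minimal subsetI)
    then show ?thesis
      using \<open>a < p\<close> by simp
  qed (use p assms in auto)
  then have "g ` {a..p} \<subseteq> C"
    by auto
  moreover have "a \<le> p" "p \<le> s"
    using p assms by auto
  ultimately show thesis
    using that p(2) by blast
qed

text \<open>The first hit of the curve run backwards.\<close>

lemma last_hit:
  fixes g :: "real \<Rightarrow> 'a::t2_space"
  assumes "continuous_on {a..b} g" "closed C" "closed D" "g ` {a..b} \<subseteq> C \<union> D"
    and "g b \<in> C" "s \<in> {a..b}" "g s \<in> D"
  obtains q where "s \<le> q" "q \<le> b" "g q \<in> D" "g ` {q..b} \<subseteq> C"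
proof -
  have "continuous_on {-b..-a} (\<lambda>x. g (- x))"
    by (intro continuous_on_compose2[OF assms(1)] continuous_intros) auto
  moreover have "g (- x) \<in> C \<union> D" if "x \<in> {-b..-a}" for x
    using assms(4) that by (simp add: image_subset_iff)
  then have "(\<lambda>x. g (- x)) ` {-b..-a} \<subseteq> C \<union> D"
    by blast
  ultimately obtain p where p: "-b \<le> p" "p \<le> - s" "g (- p) \<in> D"
    "(\<lambda>x. g (- x)) ` {-b..p} \<subseteq> C"
    using first_hit[of "-b" "-a" "\<lambda>x. g (- x)" C D "- s"] assms by auto
  have "g x \<in> C" if "x \<in> {- p..b}" for x
  proof -
    have "- x \<in> {-b..p}"
      using that by auto
    then show ?thesis
      using subsetD[OF p(4) imageI, of "- x"] by simp
  qed
  then have "g ` {- p..b} \<subseteq> C"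
    by (rule image_subsetI)
  then show thesis
    using that[of "- p"] p by auto
qed

text \<open>The total turning of a curve from the angle \<open>\<phi>\<close> splits into a part \<open>t\<close> made on the side and
  a part \<open>v\<close> made across caps; all the caps crossed are charged by one chord.\<close>

definition wraps :: "real \<Rightarrow> (real^3) set \<Rightarrow> bool" where
  "wraps h C \<longleftrightarrow> (\<forall>g a b \<phi> z. a \<le> b \<longrightarrow> continuous_on {a..b} g \<longrightarrow> g ` {a..b} \<subseteq> C \<longrightarrow>
     g a = cyl 1 \<phi> z \<longrightarrow> g b \<in> side h \<longrightarrow>
     (\<exists>t v. g b = cyl 1 (\<phi> + t + v) (g b $ 3) \<and>
        ennreal (sqrt ((g b $ 3 - z)\<^sup>2 + t\<^sup>2) + chord v) \<le> curve_length g a b))"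

lemma wrapsE:
  assumes "wraps h C" "a \<le> b" "continuous_on {a..b} g" "g ` {a..b} \<subseteq> C"
    "g a = cyl 1 \<phi> z" "g b \<in> side h"
  obtains t v where "g b = cyl 1 (\<phi> + t + v) (g b $ 3)"
    "ennreal (sqrt ((g b $ 3 - z)\<^sup>2 + t\<^sup>2) + chord v) \<le> curve_length g a b"
  using assms unfolding wraps_def by metis

lemma wraps_side: "wraps h (side h)"
  unfolding wraps_def
proof (intro allI impI)
  fix g :: "real \<Rightarrow> real^3" and a b \<phi> z :: real
  assume "a \<le> b" "continuous_on {a..b} g" "g ` {a..b} \<subseteq> side h" "g a = cyl 1 \<phi> z"
  then obtain t where "g b = cyl 1 (\<phi> + t) (g b $ 3)"
    "ennreal (sqrt ((g b $ 3 - z)\<^sup>2 + t\<^sup>2)) \<le> curve_length g a b"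
    by (rule side_curve_length_ge)
  then show "\<exists>t v. g b = cyl 1 (\<phi> + t + v) (g b $ 3) \<and>
      ennreal (sqrt ((g b $ 3 - z)\<^sup>2 + t\<^sup>2) + chord v) \<le> curve_length g a b"
    by (intro exI[of _ t] exI[of _ 0]) (simp add: chord_def)
qed

text \<open>Between the first and the last visit to the cap \<open>D\<close> only the straight distance is charged,
  so it does not matter what the curve does there.\<close>

lemma cap_curve_length_ge:
  assumes "closed C" "wraps h C" "closed D"
    and rim: "\<And>x. x \<in> C \<Longrightarrow> x \<in> D \<Longrightarrow> x \<in> side h \<and> x $ 3 = k"
    and g: "continuous_on {a..b} g" "g ` {a..b} \<subseteq> C \<union> D" "s \<in> {a..b}" "g s \<in> D"
      "g a = cyl 1 \<phi> z" "g a \<in> C" "g b \<in> C" "g b \<in> side h"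
  obtains t u v where "g b = cyl 1 (\<phi> + t + u + v) (g b $ 3)"
    "ennreal (sqrt ((k - z)\<^sup>2 + t\<^sup>2) + sqrt ((k - g b $ 3)\<^sup>2 + u\<^sup>2) + chord v) \<le> curve_length g a b"
proof -
  obtain p where p: "a \<le> p" "p \<le> s" "g p \<in> D" "g ` {a..p} \<subseteq> C"
    using first_hit[OF g(1) assms(1,3) g(2) g(6,3,4)] by blast
  obtain q where q: "s \<le> q" "q \<le> b" "g q \<in> D" "g ` {q..b} \<subseteq> C"
    using last_hit[OF g(1) assms(1,3) g(2) g(7,3,4)] by blast
  have gp: "g p \<in> side h" "g p $ 3 = k" and gq: "g q \<in> side h" "g q $ 3 = k"
    using rim[of "g p"] rim[of "g q"] subsetD[OF p(4) imageI, of p] subsetD[OF q(4) imageI, of q] p q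
    by auto
  have "continuous_on {a..p} g" "continuous_on {q..b} g"
    using g(1) p q by (auto elim!: continuous_on_subset)
  note cont = this
  obtain t v where t: "g p = cyl 1 (\<phi> + t + v) k"
    "ennreal (sqrt ((k - z)\<^sup>2 + t\<^sup>2) + chord v) \<le> curve_length g a p"
    using wrapsE[OF assms(2) p(1) cont(1) p(4) g(5) gp(1)] gp(2) by metis
  obtain \<psi> where \<psi>: "g q = cyl 1 \<psi> k"
    using gq in_sideE by metis
  obtain u w where u: "g b = cyl 1 (\<psi> + u + w) (g b $ 3)"
    "ennreal (sqrt ((g b $ 3 - k)\<^sup>2 + u\<^sup>2) + chord w) \<le> curve_length g q b"
    using wrapsE[OF assms(2) q(2) cont(2) q(4) \<psi> g(8)] by metis
  \<comment> \<open>The turn across the middle part. The choice of \<open>\<psi>\<close> leaves it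
    open up to full turns, which do not change its chord.\<close>
  define x where "x = \<psi> - (\<phi> + t + v)"
  have pq: "ennreal (chord x) \<le> curve_length g p q"
    using dist_le_curve_length[of p q g] p q by (simp add: t(1) \<psi> dist_cyl_same_height x_def)
  show thesis
  proof
    show "g b = cyl 1 (\<phi> + t + u + (v + x + w)) (g b $ 3)"
      using u(1) by (simp add: x_def algebra_simps)
    \<comment> \<open>The cap turns before \<open>p\<close>, between \<open>p\<close> and
      \<open>q\<close>, and after \<open>q\<close> are collected into one chord.\<close>
    have "chord (v + x + w) \<le> chord v + chord x + chord w"
      using chord_add_le[of "v + x" w] chord_add_le[of v x] by simp
    then have "ennreal (sqrt ((k - z)\<^sup>2 + t\<^sup>2) + sqrt ((k - g b $ 3)\<^sup>2 + u\<^sup>2) + chord (v + x + w))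
      \<le> ennreal ((sqrt ((k - z)\<^sup>2 + t\<^sup>2) + chord v) + (chord x + (sqrt ((g b $ 3 - k)\<^sup>2 + u\<^sup>2) + chord w)))"
      by (intro ennreal_leI) (simp add: power2_commute)
    also have "\<dots> = ennreal (sqrt ((k - z)\<^sup>2 + t\<^sup>2) + chord v) + (ennreal (chord x)
        + ennreal (sqrt ((g b $ 3 - k)\<^sup>2 + u\<^sup>2) + chord w))"
      by (simp add: chord_nonneg flip: ennreal_plus)
    also have "\<dots> \<le> curve_length g a p + (curve_length g p q + curve_length g q b)"
      by (intro add_mono t u pq)
    also have "\<dots> = curve_length g a b"
      using p q by (simp add: curve_length_split[of a p b] curve_length_split[of p q b])
    finally show "ennreal (sqrt ((k - z)\<^sup>2 + t\<^sup>2) + sqrt ((k - g b $ 3)\<^sup>2 + u\<^sup>2) + chord (v + x + w))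
      \<le> curve_length g a b" .
  qed
qed

text \<open>A detour over the base is not shorter than staying on the side and making its chord elsewhere:
  \<open>\<bar>w - z\<bar> \<le> w + z\<close> for heights \<open>z, w \<ge> 0\<close>.\<close>

lemma wraps_side_Un_base:
  assumes "0 \<le> h"
  shows "wraps h (side h \<union> base)"
  unfolding wraps_def
proof (intro allI impI)
  fix g :: "real \<Rightarrow> real^3" and a b \<phi> z :: real
  assume g: "a \<le> b" "continuous_on {a..b} g" "g ` {a..b} \<subseteq> side h \<union> base" "g a = cyl 1 \<phi> z"
    "g b \<in> side h"
  let ?w = "g b $ 3"
  \<comment> \<open>A point at distance 1 from the axis that lies in the base is on its rim, hence
    on the side.\<close>
  have "g a \<in> side h"
  proof -
    have "g a \<in> side h \<union> base"
      using subsetD[OF g(3) imageI, of a] g(1) by simp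
    then show ?thesis
      using assms by (auto simp: g(4) side_eq base_eq lid_eq)
  qed
  then have z: "0 \<le> z"
    using side_nth_3 g(4) by fastforce
  have w: "0 \<le> ?w"
    using side_nth_3[OF g(5)] by simp
  show "\<exists>t v. g b = cyl 1 (\<phi> + t + v) ?w \<and>
      ennreal (sqrt ((?w - z)\<^sup>2 + t\<^sup>2) + chord v) \<le> curve_length g a b"
  proof (cases "\<exists>s\<in>{a..b}. g s \<in> base")
    case True
    then obtain s where s: "s \<in> {a..b}" "g s \<in> base" by blast
    obtain t u v where *: "g b = cyl 1 (\<phi> + t + u + v) ?w"
      "ennreal (sqrt ((0 - z)\<^sup>2 + t\<^sup>2) + sqrt ((0 - ?w)\<^sup>2 + u\<^sup>2) + chord v) \<le> curve_length g a b"
    proof (rule cap_curve_length_ge[of "side h" h base 0 a b g s \<phi> z])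
      show "closed (side h)" "closed base" "wraps h (side h)"
        by (simp_all add: closed_side base_eq closed_lid wraps_side)
      show "x \<in> side h \<and> x $ 3 = 0" if "x \<in> side h" "x \<in> base" for x
        using that by (simp add: base_eq lid_eq)
    qed (use g s \<open>g a \<in> side h\<close> in auto)
    have "(?w - z)\<^sup>2 \<le> (z + ?w)\<^sup>2"
      using z w by (simp add: abs_le_square_iff[symmetric])
    then have "sqrt ((?w - z)\<^sup>2 + (t + u)\<^sup>2) \<le> sqrt ((z + ?w)\<^sup>2 + (t + u)\<^sup>2)"
      by simp
    also have "\<dots> \<le> sqrt (z\<^sup>2 + t\<^sup>2) + sqrt (?w\<^sup>2 + u\<^sup>2)"
      by (rule real_sqrt_sum_squares_triangle_ineq)
    finally have "ennreal (sqrt ((?w - z)\<^sup>2 + (t + u)\<^sup>2) + chord v)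
        \<le> ennreal (sqrt ((0 - z)\<^sup>2 + t\<^sup>2) + sqrt ((0 - ?w)\<^sup>2 + u\<^sup>2) + chord v)"
      by (intro ennreal_leI) simp
    also note *(2)
    finally have "ennreal (sqrt ((?w - z)\<^sup>2 + (t + u)\<^sup>2) + chord v) \<le> curve_length g a b" .
    then show ?thesis
      using *(1) by (intro exI[of _ "t + u"] exI[of _ v]) (simp add: add.assoc)
  next
    case False
    then have "g ` {a..b} \<subseteq> side h"
      using g(3) by auto
    then show ?thesis
      using wraps_side[of h] g unfolding wraps_def by blast
  qed
qed

subsection \<open>Lengths of the candidates\<close>

text \<open>Turns with the same effect have equal cosine, and cosine decreases strictly on
  \<open>[0, pi]\<close>, so a turn smaller in absolute value than \<open>\<psi> - \<phi>\<close>
  would have a larger cosine.\<close>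

lemma abs_diff_le_turn:
  assumes "cyl 1 (\<phi> + t) w = cyl 1 \<psi> w" "\<bar>\<psi> - \<phi>\<bar> \<le> pi"
  shows "\<bar>\<psi> - \<phi>\<bar> \<le> \<bar>t\<bar>"
proof (rule ccontr)
  assume "\<not> ?thesis"
  then have "cos \<bar>\<psi> - \<phi>\<bar> < cos \<bar>t\<bar>"
    using assms(2) by (intro cos_monotone_0_pi) auto
  moreover have "cos ((\<phi> + t) - \<phi>) = cos (\<psi> - \<phi>)"
    using assms(1) unfolding cos_diff cyl_1_eq_iff by simp
  ultimately show False by simp
qed

text \<open>A path may wind around the side in either direction, but its turn is never smaller than
  the direct one of at most \<open>pi\<close>.\<close>

lemma side_path_length_ge:
  assumes "path_from_to (side h) (cyl 1 \<phi> z) (cyl 1 \<psi> w) g" "\<bar>\<psi> - \<phi>\<bar> \<le> pi"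
  shows "ennreal (sqrt ((w - z)\<^sup>2 + (\<psi> - \<phi>)\<^sup>2)) \<le> path_length g"
proof -
  have g: "continuous_on {0..1} g" "g ` {0..1} \<subseteq> side h" "g 0 = cyl 1 \<phi> z" "g 1 = cyl 1 \<psi> w"
    using assms(1) by (auto simp: path_from_to_def path_def path_image_def pathstart_def pathfinish_def)
  obtain t where t: "g 1 = cyl 1 (\<phi> + t) (g 1 $ 3)"
    "ennreal (sqrt ((g 1 $ 3 - z)\<^sup>2 + t\<^sup>2)) \<le> curve_length g 0 1"
    using side_curve_length_ge[of 0 1 g h \<phi> z] g by auto
  have "\<bar>\<psi> - \<phi>\<bar> \<le> \<bar>t\<bar>"
    using t(1) g(4) assms(2) by (intro abs_diff_le_turn[of _ _ w]) auto
  then have "ennreal (sqrt ((w - z)\<^sup>2 + (\<psi> - \<phi>)\<^sup>2)) \<le> ennreal (sqrt ((w - z)\<^sup>2 + t\<^sup>2))"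
    by (intro ennreal_leI) (simp add: abs_le_square_iff)
  also have "\<dots> \<le> path_length g"
    using t(2) g(4) by (simp add: path_length_eq_curve_length)
  finally show ?thesis .
qed

text \<open>The image of a straight segment of the unrolled strip, run at constant speed.\<close>

definition helix :: "real \<Rightarrow> real \<Rightarrow> real \<Rightarrow> real \<Rightarrow> real \<Rightarrow> real^3" where
  "helix \<phi> z \<psi> w s = cyl 1 (\<phi> + s * (\<psi> - \<phi>)) (z + s * (w - z))"

lemma helix_path:
  assumes "0 \<le> z" "z \<le> h" "0 \<le> w" "w \<le> h"
  shows "path_from_to (side h) (cyl 1 \<phi> z) (cyl 1 \<psi> w) (helix \<phi> z \<psi> w)"
proof -
  have "continuous_on {0..1} (helix \<phi> z \<psi> w)"
  proof -
    have "continuous_on {0..1} (\<lambda>s. helix \<phi> z \<psi> w s $ i)" for i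
      using exhaust_3[of i]
      by (elim disjE; simp add: helix_def; intro continuous_intros)
    then have "continuous_on {0..1} (\<lambda>s. \<chi> i. helix \<phi> z \<psi> w s $ i)"
      by (rule continuous_on_vec_lambda)
    then show ?thesis by simp
  qed
  moreover have "helix \<phi> z \<psi> w s \<in> side h" if "s \<in> {0..1}" for s
  proof -
    have "z + s * (w - z) \<in> {0..h}"
      using convexD_alt[OF convex_real_interval(5)[of 0 h], of z w s] that assms
      by (simp add: algebra_simps)
    then show ?thesis
      by (auto simp: helix_def side_def)
  qed
  ultimately show ?thesis
    by (auto simp: path_from_to_def path_def path_image_def pathstart_def pathfinish_def helix_def)
qed

text \<open>Rolling up the plane does not increase distances, since chords are at most arcs; so the
  length of the plane segment is a Lipschitz constant.\<close>

lemma helix_path_length_le: "path_length (helix \<phi> z \<psi> w) \<le> ennreal (sqrt ((w - z)\<^sup>2 + (\<psi> - \<phi>)\<^sup>2))"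
proof -
  have "dist (helix \<phi> z \<psi> w x) (helix \<phi> z \<psi> w y) \<le> sqrt ((w - z)\<^sup>2 + (\<psi> - \<phi>)\<^sup>2) * (y - x)"
    if "x \<le> y" for x y
  proof -
    have "dist (helix \<phi> z \<psi> w x) (helix \<phi> z \<psi> w y)
        \<le> sqrt (((y - x) * (w - z))\<^sup>2 + ((y - x) * (\<psi> - \<phi>))\<^sup>2)"
      unfolding helix_def by (rule dist_cyl_le[THEN order_trans]) (simp add: left_diff_distrib)
    also have "\<dots> = sqrt (((w - z)\<^sup>2 + (\<psi> - \<phi>)\<^sup>2) * (y - x)\<^sup>2)"
      by (simp add: power_mult_distrib distrib_left mult.commute)
    also have "\<dots> = sqrt ((w - z)\<^sup>2 + (\<psi> - \<phi>)\<^sup>2) * (y - x)"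
      using that by (simp add: real_sqrt_mult)
    finally show ?thesis .
  qed
  then show ?thesis
    using curve_length_le_Lipschitz[of 0 1 "helix \<phi> z \<psi> w" "sqrt ((w - z)\<^sup>2 + (\<psi> - \<phi>)\<^sup>2)"]
    by (simp add: path_length_eq_curve_length)
qed

lemma helix_minimal:
  assumes "0 \<le> z" "z \<le> h" "0 \<le> w" "w \<le> h" "\<bar>\<psi> - \<phi>\<bar> \<le> pi"
  shows "minimal_path (side h) (cyl 1 \<phi> z) (cyl 1 \<psi> w) (helix \<phi> z \<psi> w)"
  unfolding minimal_path_def
  using helix_path[of z h w \<phi> \<psi>] helix_path_length_le[of \<phi> z \<psi> w] side_path_length_ge[of h \<phi> z \<psi> w] assms
  by (meson order_trans)

text \<open>Minimality alone fixes the length: the helix bounds it above and unrolling bounds it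
  below.\<close>

lemma minimal_path_side_length:
  assumes "minimal_path (side h) (cyl 1 \<phi> z) (cyl 1 \<psi> w) g"
    and "0 \<le> z" "z \<le> h" "0 \<le> w" "w \<le> h" "\<bar>\<psi> - \<phi>\<bar> \<le> pi"
  shows "path_length g = ennreal (sqrt ((w - z)\<^sup>2 + (\<psi> - \<phi>)\<^sup>2))"
proof (rule antisym)
  show "path_length g \<le> ennreal (sqrt ((w - z)\<^sup>2 + (\<psi> - \<phi>)\<^sup>2))"
    using assms helix_path[of z h w \<phi> \<psi>] helix_path_length_le[of \<phi> z \<psi> w]
    unfolding minimal_path_def by (meson order_trans)
  show "ennreal (sqrt ((w - z)\<^sup>2 + (\<psi> - \<phi>)\<^sup>2)) \<le> path_length g"
    using assms side_path_length_ge unfolding minimal_path_def by blast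
qed

section \<open>Crossings of a cap\<close>

text \<open>One formula for both caps: \<open>a\<close> and \<open>b\<close> stand for the signed
  heights \<open>k - zA\<close> and \<open>k - zB\<close>, which are at most 0 when
  \<open>k = 0\<close>.\<close>

definition crossing_length :: "real \<Rightarrow> real \<Rightarrow> real \<Rightarrow> real \<Rightarrow> real \<Rightarrow> real" where
  "crossing_length a b \<theta> t u = sqrt (a\<^sup>2 + t\<^sup>2) + sqrt (b\<^sup>2 + u\<^sup>2) + chord (\<theta> - t - u)"

lemma crossing_ends:
  assumes "minimal_path X P Q \<gamma>" "minimal_path X' R T \<gamma>'"
  shows "pathstart \<gamma> = P" "pathfinish \<gamma> = Q" "pathstart \<gamma>' = R" "pathfinish \<gamma>' = T"
  using assms by (auto simp: minimal_path_def path_from_to_def)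

context
  fixes h \<theta> zA zB k :: real
  assumes z: "0 \<le> zA" "zA \<le> h" "0 \<le> zB" "zB \<le> h" and k: "0 \<le> k" "k \<le> h"
    and \<theta>: "0 \<le> \<theta>" "\<theta> \<le> pi"
begin

lemma crossing_ex:
  assumes "t \<in> {0..\<theta>}" "u \<in> {0..\<theta>}"
  shows "\<exists>\<beta>. crossing h k \<theta> (cyl 1 0 zA) (cyl 1 \<theta> zB) t u \<beta>"
  unfolding crossing_def
  using helix_minimal[of zA h k t 0] helix_minimal[of k h zB \<theta> "\<theta> - u"] z k \<theta> assms by fastforce

lemma crossing_path_length:
  assumes "crossing h k \<theta> (cyl 1 0 zA) (cyl 1 \<theta> zB) t u \<beta>" "t \<in> {0..\<theta>}" "u \<in> {0..\<theta>}"
  shows "path_length \<beta> = ennreal (crossing_length (k - zA) (k - zB) \<theta> t u)"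
proof -
  obtain \<gamma> \<gamma>' where g: "minimal_path (side h) (cyl 1 0 zA) (cyl 1 t k) \<gamma>"
    "minimal_path (side h) (cyl 1 (\<theta> - u) k) (cyl 1 \<theta> zB) \<gamma>'"
    "\<beta> = \<gamma> +++ (linepath (cyl 1 t k) (cyl 1 (\<theta> - u) k) +++ \<gamma>')"
    using assms(1) unfolding crossing_def by blast
  have "path_length \<gamma> = ennreal (sqrt ((k - zA)\<^sup>2 + t\<^sup>2))"
    using minimal_path_side_length[OF g(1)] z k \<theta> assms by simp
  moreover have "path_length \<gamma>' = ennreal (sqrt ((zB - k)\<^sup>2 + u\<^sup>2))"
    using minimal_path_side_length[OF g(2)] z k \<theta> assms by simp
  moreover have "path_length \<beta> = path_length \<gamma> + (ennreal (chord (\<theta> - u - t)) + path_length \<gamma>')"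
    using crossing_ends[OF g(1,2)]
    by (simp add: g(3) path_length_join path_length_linepath dist_cyl_same_height)
  ultimately show ?thesis
    by (simp add: crossing_length_def chord_nonneg power2_commute[of zB] algebra_simps flip: ennreal_plus)
qed

lemma crossing_path_from_to:
  assumes "crossing h k \<theta> (cyl 1 0 zA) (cyl 1 \<theta> zB) t u \<beta>" "k = 0 \<or> k = h"
  shows "path_from_to (soup_can h) (cyl 1 0 zA) (cyl 1 \<theta> zB) \<beta>"
proof -
  obtain \<gamma> \<gamma>' where g: "minimal_path (side h) (cyl 1 0 zA) (cyl 1 t k) \<gamma>"
    "minimal_path (side h) (cyl 1 (\<theta> - u) k) (cyl 1 \<theta> zB) \<gamma>'"
    "\<beta> = \<gamma> +++ (linepath (cyl 1 t k) (cyl 1 (\<theta> - u) k) +++ \<gamma>')"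
    using assms(1) unfolding crossing_def by blast
  \<comment> \<open>The chord lies in the disc at height \<open>k\<close> by convexity; that disc
    belongs to the can because \<open>k\<close> is \<open>0\<close> or \<open>h\<close>.\<close>
  have "closed_segment (cyl 1 t k) (cyl 1 (\<theta> - u) k) \<subseteq> lid k"
    by (intro closed_segment_subset convex_lid) (auto simp: lid_eq)
  then have "path_image (linepath (cyl 1 t k) (cyl 1 (\<theta> - u) k)) \<subseteq> soup_can h"
    using assms(2) by (auto simp: soup_can_def base_eq)
  moreover have "path \<gamma>" "path \<gamma>'" "path_image \<gamma> \<subseteq> soup_can h" "path_image \<gamma>' \<subseteq> soup_can h"
    using g by (auto simp: minimal_path_def path_from_to_def soup_can_def)
  ultimately show ?thesis
    using crossing_ends[OF g(1,2)]
    by (simp add: g(3) path_from_to_def subset_path_image_join)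
qed

text \<open>The length depends on \<open>(t, u)\<close> alone and is continuous on a compact square,
  so a crossing at a minimum of the formula is shortest.\<close>

lemma minimal_crossing_ex:
  "\<exists>\<beta>. minimal_crossing h k \<theta> (cyl 1 0 zA) (cyl 1 \<theta> zB) \<beta>"
proof -
  let ?f = "\<lambda>(t, u). crossing_length (k - zA) (k - zB) \<theta> t u"
  have "compact ({0..\<theta>} \<times> {0..\<theta>})" "{0..\<theta>} \<times> {0..\<theta>} \<noteq> {}"
    using \<theta> by (auto intro: compact_Times)
  moreover have "continuous_on ({0..\<theta>} \<times> {0..\<theta>}) ?f"
    unfolding crossing_length_def chord_def case_prod_beta by (intro continuous_intros)
  ultimately obtain x where x: "x \<in> {0..\<theta>} \<times> {0..\<theta>}" "\<And>y. y \<in> {0..\<theta>} \<times> {0..\<theta>} \<Longrightarrow> ?f x \<le> ?f y"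
    using continuous_attains_inf[of "{0..\<theta>} \<times> {0..\<theta>}" ?f] by blast
  obtain t u where [simp]: "x = (t, u)" by fastforce
  have tu: "t \<in> {0..\<theta>}" "u \<in> {0..\<theta>}"
    using x(1) by auto
  obtain \<beta> where \<beta>: "crossing h k \<theta> (cyl 1 0 zA) (cyl 1 \<theta> zB) t u \<beta>"
    using crossing_ex[OF tu] by blast
  have "path_length \<beta> \<le> path_length \<beta>'"
    if "t' \<in> {0..\<theta>}" "u' \<in> {0..\<theta>}" "crossing h k \<theta> (cyl 1 0 zA) (cyl 1 \<theta> zB) t' u' \<beta>'" for t' u' \<beta>'
    using x(2)[of "(t', u')"] that
    by (simp add: crossing_path_length[OF \<beta> tu] crossing_path_length[OF that(3,1,2)] ennreal_leI)
  then show ?thesis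
    using \<beta> tu unfolding minimal_crossing_def by blast
qed

lemma minimal_crossing_le:
  assumes "minimal_crossing h k \<theta> (cyl 1 0 zA) (cyl 1 \<theta> zB) \<beta>" "t \<in> {0..\<theta>}" "u \<in> {0..\<theta>}"
  shows "path_length \<beta> \<le> ennreal (crossing_length (k - zA) (k - zB) \<theta> t u)"
  using assms crossing_ex[OF assms(2,3)] crossing_path_length[OF _ assms(2,3)]
  unfolding minimal_crossing_def by metis

lemma minimal_crossing_path_from_to:
  assumes "minimal_crossing h k \<theta> (cyl 1 0 zA) (cyl 1 \<theta> zB) \<beta>" "k = 0 \<or> k = h"
  shows "path_from_to (soup_can h) (cyl 1 0 zA) (cyl 1 \<theta> zB) \<beta>"
  using assms crossing_path_from_to unfolding minimal_crossing_def by blast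

end

subsection \<open>Minimality\<close>

text \<open>If the side pieces turn by less than \<open>\<theta>\<close> altogether, turning each of them towards the target
  shortens the chord. Otherwise the side pieces alone, unrolled in the plane, are at least as long
  as the geodesic on the side.\<close>

lemma crossing_length_reduce:
  assumes "0 \<le> a * b" "0 \<le> \<theta>" "\<theta> \<le> pi"
  shows "sqrt ((a - b)\<^sup>2 + \<theta>\<^sup>2) \<le> crossing_length a b \<theta> t u \<or>
    (\<exists>t'\<in>{0..\<theta>}. \<exists>u'\<in>{0..\<theta>}. crossing_length a b \<theta> t' u' \<le> crossing_length a b \<theta> t u)"
proof (cases "\<theta> \<le> \<bar>t\<bar> + \<bar>u\<bar>")
  case True
  \<comment> \<open>Both ends lie on the same side of the rim, so reflecting one of them in it can
    only increase the height difference.\<close>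
  have "(a - b)\<^sup>2 \<le> (a + b)\<^sup>2"
    using assms(1) by (simp add: power2_diff power2_sum)
  moreover have "\<theta>\<^sup>2 \<le> (\<bar>t\<bar> + \<bar>u\<bar>)\<^sup>2"
    using True assms(2) by (rule power_mono)
  ultimately have "sqrt ((a - b)\<^sup>2 + \<theta>\<^sup>2) \<le> sqrt ((a + b)\<^sup>2 + (\<bar>t\<bar> + \<bar>u\<bar>)\<^sup>2)"
    by simp
  also have "\<dots> \<le> sqrt (a\<^sup>2 + \<bar>t\<bar>\<^sup>2) + sqrt (b\<^sup>2 + \<bar>u\<bar>\<^sup>2)"
    by (rule real_sqrt_sum_squares_triangle_ineq)
  also have "\<dots> \<le> crossing_length a b \<theta> t u"
    by (simp add: crossing_length_def chord_nonneg)
  finally show ?thesis ..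
next
  case False
  \<comment> \<open>\<open>y\<close> lies between \<open>x\<close> and its mirror image
    \<open>2 * pi - x\<close>, where the cosine is at most \<open>cos x\<close>; so the chord over
    \<open>x\<close> is no longer than that over \<open>y\<close>.\<close>
  define x y where "x = \<theta> - \<bar>t\<bar> - \<bar>u\<bar>" and "y = \<theta> - t - u"
  have xy: "0 \<le> x" "x \<le> y" "y \<le> 2 * pi - x"
    using False assms by (auto simp: x_def y_def)
  have "cos y \<le> cos x"
  proof (cases "y \<le> pi")
    case True
    then show ?thesis
      using xy by (intro cos_monotone_0_pi_le) auto
  next
    case False
    then have "cos (2 * pi - y) \<le> cos x"
      using xy by (intro cos_monotone_0_pi_le) auto
    then show ?thesis
      by (simp add: cos_diff)
  qed
  then have "crossing_length a b \<theta> \<bar>t\<bar> \<bar>u\<bar> \<le> crossing_length a b \<theta> t u"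
    by (simp add: crossing_length_def chord_def x_def y_def)
  moreover have "\<bar>t\<bar> \<in> {0..\<theta>}" "\<bar>u\<bar> \<in> {0..\<theta>}"
    using False by auto
  ultimately show ?thesis by blast
qed

text \<open>The lid is looked for first: visits to the base before or after it are covered by
  \<open>wraps_side_Un_base\<close>. If the lid is missed, the base is the only cap; if both are
  missed, the path stays on the side.\<close>

lemma can_path_length_ge:
  assumes "0 < h" "path_from_to (soup_can h) (cyl 1 0 zA) (cyl 1 \<theta> zB) g"
    and "cyl 1 0 zA \<in> side h" "cyl 1 \<theta> zB \<in> side h" "0 \<le> \<theta>" "\<theta> \<le> pi"
  shows "ennreal (sqrt ((zB - zA)\<^sup>2 + \<theta>\<^sup>2)) \<le> path_length g \<or>
    (\<exists>k\<in>{0, h}. \<exists>t\<in>{0..\<theta>}. \<exists>u\<in>{0..\<theta>}.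
       ennreal (crossing_length (k - zA) (k - zB) \<theta> t u) \<le> path_length g)"
proof -
  have g: "continuous_on {0..1} g" "g ` {0..1} \<subseteq> soup_can h" "g 0 = cyl 1 0 zA" "g 1 = cyl 1 \<theta> zB"
    using assms(2) by (auto simp: path_from_to_def path_def path_image_def pathstart_def pathfinish_def)
  have z: "0 \<le> zA" "zA \<le> h" "0 \<le> zB" "zB \<le> h"
    using assms(3,4)[THEN side_nth_3] by auto
  \<comment> \<open>One argument serves both caps: \<open>k\<close> is the height of the cap and
    \<open>C\<close> contains what lies outside it.\<close>
  have cap: ?thesis
    if C: "closed C" "wraps h C" "side h \<subseteq> C" "C \<inter> lid k \<subseteq> side h" "k \<in> {0, h}"
      "g ` {0..1} \<subseteq> C \<union> lid k" "s \<in> {0..1}" "g s \<in> lid k" for C k s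
  proof -
    obtain t u v where *: "g 1 = cyl 1 (0 + t + u + v) (g 1 $ 3)"
      "ennreal (sqrt ((k - zA)\<^sup>2 + t\<^sup>2) + sqrt ((k - g 1 $ 3)\<^sup>2 + u\<^sup>2) + chord v) \<le> curve_length g 0 1"
    proof (rule cap_curve_length_ge[of C h "lid k" k 0 1 g s 0 zA])
      show "x \<in> side h \<and> x $ 3 = k" if "x \<in> C" "x \<in> lid k" for x
        using that \<open>C \<inter> lid k \<subseteq> side h\<close> by (auto simp: lid_eq)
    qed (use C g assms closed_lid in auto)
    \<comment> \<open>The end angle \<open>\<theta>\<close> equals \<open>t + u + v\<close> only up
      to full turns, which suffices as the chord depends on the cosine alone.\<close>
    have "cos \<theta> = cos (t + u + v)" "sin \<theta> = sin (t + u + v)"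
      using *(1) g(4) by (auto simp: cyl_1_eq_iff)
    then have "cos (\<theta> - (t + u)) = cos (t + u + v - (t + u))"
      unfolding cos_diff by simp
    then have "chord (\<theta> - t - u) = chord v"
      by (simp add: chord_def algebra_simps)
    then have L: "ennreal (crossing_length (k - zA) (k - zB) \<theta> t u) \<le> path_length g"
      using *(2) g(4) by (simp add: crossing_length_def path_length_eq_curve_length)
    \<comment> \<open>Both factors are nonnegative for \<open>k = h\<close> and nonpositive for
      \<open>k = 0\<close>.\<close>
    have "0 \<le> (k - zA) * (k - zB)"
      using that(5) z by (auto simp: zero_le_mult_iff)
    from crossing_length_reduce[OF this assms(5,6), of t u] show ?thesis
    proof
      assume "sqrt ((k - zA - (k - zB))\<^sup>2 + \<theta>\<^sup>2) \<le> crossing_length (k - zA) (k - zB) \<theta> t u"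
      then have "ennreal (sqrt ((zB - zA)\<^sup>2 + \<theta>\<^sup>2)) \<le> ennreal (crossing_length (k - zA) (k - zB) \<theta> t u)"
        by (intro ennreal_leI) simp
      with L show ?thesis
        using order_trans by blast
    next
      assume "\<exists>t'\<in>{0..\<theta>}. \<exists>u'\<in>{0..\<theta>}.
        crossing_length (k - zA) (k - zB) \<theta> t' u' \<le> crossing_length (k - zA) (k - zB) \<theta> t u"
      with L that(5) show ?thesis
        by (meson ennreal_leI order_trans)
    qed
  qed
  consider s where "s \<in> {0..1}" "g s \<in> lid h"
    | s where "s \<in> {0..1}" "g s \<in> lid 0" "g ` {0..1} \<subseteq> side h \<union> lid 0"
    | "g ` {0..1} \<subseteq> side h"
    using g(2) unfolding soup_can_def base_eq by blast
  then show ?thesis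
  proof cases
    case 1
    show ?thesis
    proof (rule cap[of "side h \<union> base" h s])
      show "closed (side h \<union> base)" "wraps h (side h \<union> base)"
        using assms(1) wraps_side_Un_base[of h] by (auto simp: closed_side closed_lid base_eq)
      \<comment> \<open>Lid and base are disjoint because \<open>0 < h\<close>.\<close>
      show "(side h \<union> base) \<inter> lid h \<subseteq> side h"
        using assms(1) by (auto simp: base_eq lid_eq)
    qed (use 1 g(2) in \<open>auto simp: soup_can_def\<close>)
  next
    case 2
    show ?thesis
      by (rule cap[of "side h" 0 s]) (use 2 closed_side wraps_side in auto)
  next
    case 3
    then have "path_from_to (side h) (cyl 1 0 zA) (cyl 1 \<theta> zB) g"
      using assms(2) by (simp add: path_from_to_def path_image_def)
    from side_path_length_ge[OF this] show ?thesis
      using assms by simp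
  qed
qed

text \<open>The rim point straight above attains the distance, and every rim point differs in height
  by \<open>h - z\<close>.\<close>

lemma infdist_lid_rim:
  assumes "z \<le> h"
  shows "infdist (cyl 1 \<phi> z) (lid_rim h) = h - z"
proof (rule antisym)
  have "infdist (cyl 1 \<phi> z) (lid_rim h) \<le> dist (cyl 1 \<phi> z) (cyl 1 \<phi> h)"
    by (rule infdist_le) (auto simp: lid_rim_def)
  also have "\<dots> = h - z"
    using assms by (simp add: dist_cyl chord_def)
  finally show "infdist (cyl 1 \<phi> z) (lid_rim h) \<le> h - z" .
  have "h - z \<le> dist (cyl 1 \<phi> z) y" if "y \<in> lid_rim h" for y
  proof -
    have "\<bar>(cyl 1 \<phi> z - y) $ 3\<bar> \<le> dist (cyl 1 \<phi> z) y"
      unfolding dist_norm by (rule component_le_norm_cart)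
    then show ?thesis
      using that by (auto simp: lid_rim_def)
  qed
  moreover have "lid_rim h \<noteq> {}"
    by (auto simp: lid_rim_def)
  ultimately show "h - z \<le> infdist (cyl 1 \<phi> z) (lid_rim h)"
    by (simp add: infdist_notempty cINF_greatest)
qed

text \<open>By \<open>positioning\<close> the normal position of \<open>A\<close> and
  \<open>B\<close> is no restriction. The existence clauses keep the other clauses from holding
  vacuously.\<close>

theorem proposition6:
  fixes h \<theta> a b :: real and A B :: "real^3"
  assumes "h > 0"
    and "A \<in> side h" and "B \<in> side h" and "A \<noteq> B"
    and "\<theta> \<in> {0..pi}" and "\<theta> = half_plane_angle (half_plane A) (half_plane B)"
    and "A = cyl 1 0 (A $ 3)" and "B = cyl 1 \<theta> (B $ 3)"
    and "a = infdist A (lid_rim h)" and "b = infdist B (lid_rim h)"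
  shows "(\<forall>t\<in>{0..\<theta>}. \<forall>u\<in>{0..\<theta>}.
            (\<exists>\<beta>. crossing h h \<theta> A B t u \<beta>) \<and>
            (\<forall>\<beta>. crossing h h \<theta> A B t u \<beta> \<longrightarrow>
               path_length \<beta> = ennreal (sqrt (a\<^sup>2 + t\<^sup>2) + sqrt (b\<^sup>2 + u\<^sup>2)
                                         + sqrt (2 - 2 * cos (\<theta> - t - u))))) \<and>
         (\<forall>t\<in>{0..\<theta>}. \<forall>u\<in>{0..\<theta>}.
            (\<exists>\<beta>. crossing h 0 \<theta> A B t u \<beta>) \<and>
            (\<forall>\<beta>. crossing h 0 \<theta> A B t u \<beta> \<longrightarrow>
               path_length \<beta> = ennreal (sqrt ((h - a)\<^sup>2 + t\<^sup>2) + sqrt ((h - b)\<^sup>2 + u\<^sup>2)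
                                         + sqrt (2 - 2 * cos (\<theta> - t - u))))) \<and>
         (\<exists>\<alpha>. minimal_path (side h) A B \<alpha>) \<and>
         (\<exists>\<beta>\<^sub>1. minimal_crossing h h \<theta> A B \<beta>\<^sub>1) \<and>
         (\<exists>\<beta>\<^sub>2. minimal_crossing h 0 \<theta> A B \<beta>\<^sub>2) \<and>
         (\<forall>\<alpha> \<beta>\<^sub>1 \<beta>\<^sub>2.
            minimal_path (side h) A B \<alpha> \<longrightarrow>
            minimal_crossing h h \<theta> A B \<beta>\<^sub>1 \<longrightarrow>
            minimal_crossing h 0 \<theta> A B \<beta>\<^sub>2 \<longrightarrow>
            (\<forall>\<mu>\<in>{\<alpha>, \<beta>\<^sub>1, \<beta>\<^sub>2}. (\<forall>\<nu>\<in>{\<alpha>, \<beta>\<^sub>1, \<beta>\<^sub>2}. path_length \<mu> \<le> path_length \<nu>) \<longrightarrow>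
               minimal_path (soup_can h) A B \<mu>))"
proof -
  define zA zB where "zA = A $ 3" and "zB = B $ 3"
  have AB: "A = cyl 1 0 zA" "B = cyl 1 \<theta> zB"
    using assms by (simp_all add: zA_def zB_def)
  have z: "0 \<le> zA" "zA \<le> h" "0 \<le> zB" "zB \<le> h"
    using assms(2,3)[THEN side_nth_3] by (auto simp: zA_def zB_def)
  have \<theta>: "0 \<le> \<theta>" "\<theta> \<le> pi"
    using assms(5) by auto
  have ab: "a = h - zA" "b = h - zB"
    using assms(9,10) z by (simp_all add: AB infdist_lid_rim)
  have h: "0 \<le> h" "h \<le> h"
    using assms(1) by auto
  note lid_facts = crossing_ex[OF z h \<theta>] crossing_path_length[OF z h \<theta>]
    and base_facts = crossing_ex[OF z order_refl h(1) \<theta>] crossing_path_length[OF z order_refl h(1) \<theta>]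
  have lid: "(\<exists>\<beta>. crossing h h \<theta> A B t u \<beta>) \<and> (\<forall>\<beta>. crossing h h \<theta> A B t u \<beta> \<longrightarrow>
      path_length \<beta> = ennreal (sqrt (a\<^sup>2 + t\<^sup>2) + sqrt (b\<^sup>2 + u\<^sup>2) + sqrt (2 - 2 * cos (\<theta> - t - u))))"
    if "t \<in> {0..\<theta>}" "u \<in> {0..\<theta>}" for t u
    using lid_facts that by (auto simp: AB ab crossing_length_def chord_def)
  have base: "(\<exists>\<beta>. crossing h 0 \<theta> A B t u \<beta>) \<and> (\<forall>\<beta>. crossing h 0 \<theta> A B t u \<beta> \<longrightarrow>
      path_length \<beta> = ennreal (sqrt ((h - a)\<^sup>2 + t\<^sup>2) + sqrt ((h - b)\<^sup>2 + u\<^sup>2)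
        + sqrt (2 - 2 * cos (\<theta> - t - u))))"
    if "t \<in> {0..\<theta>}" "u \<in> {0..\<theta>}" for t u
    using base_facts that by (auto simp: AB ab crossing_length_def chord_def)
  have side: "\<exists>\<alpha>. minimal_path (side h) A B \<alpha>"
    using helix_minimal[of zA h zB \<theta> 0] z \<theta> by (auto simp: AB)
  have best: "minimal_path (soup_can h) A B \<mu>"
    if \<alpha>: "minimal_path (side h) A B \<alpha>" and \<beta>1: "minimal_crossing h h \<theta> A B \<beta>1"
      and \<beta>2: "minimal_crossing h 0 \<theta> A B \<beta>2" and \<mu>: "\<mu> \<in> {\<alpha>, \<beta>1, \<beta>2}"
      and least: "\<forall>\<nu>\<in>{\<alpha>, \<beta>1, \<beta>2}. path_length \<mu> \<le> path_length \<nu>" for \<alpha> \<beta>1 \<beta>2 \<mu>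
    unfolding minimal_path_def
  proof (intro conjI allI impI)
    have "path_from_to (soup_can h) A B \<alpha>"
      using \<alpha> by (auto simp: minimal_path_def path_from_to_def soup_can_def)
    moreover have "path_from_to (soup_can h) A B \<beta>1" "path_from_to (soup_can h) A B \<beta>2"
      using minimal_crossing_path_from_to[OF z h \<theta>] \<beta>1
        minimal_crossing_path_from_to[OF z order_refl h(1) \<theta>] \<beta>2 by (auto simp: AB)
    ultimately show "path_from_to (soup_can h) A B \<mu>"
      using \<mu> by auto
    fix g assume g: "path_from_to (soup_can h) A B g"
    have L\<alpha>: "path_length \<alpha> = ennreal (sqrt ((zB - zA)\<^sup>2 + \<theta>\<^sup>2))"
      using minimal_path_side_length[of h 0 zA \<theta> zB \<alpha>] \<alpha> z \<theta> by (simp add: AB)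
    have L\<beta>: "path_length \<beta>1 \<le> ennreal (crossing_length (h - zA) (h - zB) \<theta> t u)"
      "path_length \<beta>2 \<le> ennreal (crossing_length (0 - zA) (0 - zB) \<theta> t u)"
      if "t \<in> {0..\<theta>}" "u \<in> {0..\<theta>}" for t u
      using minimal_crossing_le[OF z h \<theta> _ that] \<beta>1
        minimal_crossing_le[OF z order_refl h(1) \<theta> _ that] \<beta>2 unfolding AB by blast+
    \<comment> \<open>The lower bound for \<open>g\<close> is the length of \<open>\<alpha>\<close>
      or of some crossing, and the minimal crossing of the same cap is no longer.\<close>
    from can_path_length_ge[OF assms(1) g[unfolded AB] assms(2,3)[unfolded AB] \<theta>]
    have "\<exists>\<nu>\<in>{\<alpha>, \<beta>1, \<beta>2}. path_length \<nu> \<le> path_length g"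
    proof (elim disjE bexE)
      fix k t u assume k: "k \<in> {0, h}" and tu: "t \<in> {0..\<theta>}" "u \<in> {0..\<theta>}"
        and le: "ennreal (crossing_length (k - zA) (k - zB) \<theta> t u) \<le> path_length g"
      from k consider "k = h" | "k = 0" by blast
      then show ?thesis
        using L\<beta>[OF tu] le by cases (blast intro: order_trans)+
    qed (use L\<alpha> in auto)
    then show "path_length \<mu> \<le> path_length g"
      using least order_trans by blast
  qed
  have "\<exists>\<beta>. minimal_crossing h h \<theta> A B \<beta>" "\<exists>\<beta>. minimal_crossing h 0 \<theta> A B \<beta>"
    using minimal_crossing_ex[OF z h \<theta>] minimal_crossing_ex[OF z order_refl h(1) \<theta>] by (auto simp: AB)
  with lid base side best show ?thesis
    by blast
qed

end
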